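(* Let $\mu>-1$, $q\ge0$, $0<\gamma<1$, and let $w:(0,\infty)\to(0,\infty)$ be an upper $q$-power weight, i.e. $w$ is positive, finite, measurable and $x\mapsto w(x)x^{-q}$ is nondecreasing on $(0,\infty)$. Then for every $\theta\in(\gamma,1)$ and all $x>0$, $$\int_0^x e^{-\gamma t}w(t)t^{-\mu}I_\mu(t)\,dt\le M\,e^{-\gamma x}w(x)x^{-\mu}I_{\mu+1}(x)$$ with $$M=M_{\mu,q,\gamma}(\theta)=\max\left\{K_{\mu,q}\exp\left(\frac{2\gamma(\mu+2)\theta}{1-\theta}\right),\ \frac{\mu+1+\theta}{(\mu+2)\theta(\theta-\gamma)}\right\}.$$ In particular (the choice $\theta=(1+\gamma)/2$) the inequality holds for all $x>0$ with $$M=\max\left\{K_{\mu,q}\exp\left(\frac{2\gamma(\mu+2)(1+\gamma)}{1-\gamma}\right),\ \frac{2(2\mu+3+\gamma)}{(\mu+2)(1-\gamma^2)}\right\}.$$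
   Context: $I_\alpha(x)=\sum_{k=0}^{\infty}\frac{(x/2)^{2k+\alpha}}{k!\,\Gamma(k+\alpha+1)}$, $x>0$, is the modified Bessel function of the first kind. $K_{\mu,q}=\max\{1,\frac{2(\mu+1)}{q+1}\}$. *)

theory Defs
  imports "HOL-Analysis.Analysis"
begin

(* Intended for x > 0. At a nonpositive integer the library has Gamma z = 0, so the
   summand is 0 there, which agrees with the usual convention 1 / Gamma z = 0. *)
definition bessel_I :: "real \<Rightarrow> real \<Rightarrow> real" where
  "bessel_I \<alpha> x =
     (\<Sum>k. (x / 2) powr (2 * real k + \<alpha>) / (fact k * Gamma (real k + \<alpha> + 1)))"

(* A weight w : (0,\<infinity>) \<rightarrow> (0,\<infinity>) is a total function real \<Rightarrow> real of which only the values
   on {0<..} matter; finiteness is built into the type. *)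
definition upper_power_weight :: "real \<Rightarrow> (real \<Rightarrow> real) \<Rightarrow> bool" where
  "upper_power_weight q w \<longleftrightarrow>
     (\<forall>x>0. w x > 0) \<and>
     w \<in> borel_measurable (lebesgue_on {0<..}) \<and>
     mono_on {0<..} (\<lambda>x. w x * x powr (- q))"

definition K_const :: "real \<Rightarrow> real \<Rightarrow> real" where
  "K_const \<mu> q = max 1 (2 * (\<mu> + 1) / (q + 1))"

definition M_const :: "real \<Rightarrow> real \<Rightarrow> real \<Rightarrow> real \<Rightarrow> real" where
  "M_const \<mu> q \<gamma> \<theta> =
     max (K_const \<mu> q * exp (2 * \<gamma> * (\<mu> + 2) * \<theta> / (1 - \<theta>)))
         ((\<mu> + 1 + \<theta>) / ((\<mu> + 2) * \<theta> * (\<theta> - \<gamma>)))"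

end

theory Submission
  imports Defs
begin

text \<open>
  Put \<open>h t = t powr (-\<mu>) * bessel_I \<mu> t\<close> and \<open>g t = t powr (-\<mu>) * bessel_I (\<mu> + 1) t\<close>. With the
  everywhere convergent series \<open>bessel_entire \<nu>\<close>, for which \<open>bessel_I \<nu> t\<close> is
  \<open>t powr \<nu> * bessel_entire \<nu> (t\<^sup>2)\<close>, these are \<open>h t = bessel_entire \<mu> (t\<^sup>2)\<close> and
  \<open>g t = t * bessel_entire (\<mu> + 1) (t\<^sup>2)\<close>. The integral of \<open>exp (- \<gamma> t) * w t * h t\<close> is estimated by
  finding, in two regimes, a function whose derivative dominates the integrand pointwise; the
  two terms of the maximum in \<open>M_const\<close> are the two resulting constants.

  Near the origin the exponential is discarded. The recurrence
  \<open>h t = 2 (\<mu> + 1) * bessel_entire (\<mu> + 1) (t\<^sup>2) + t\<^sup>2 * bessel_entire (\<mu> + 2) (t\<^sup>2)\<close> and the formula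
  \<open>(q + 1) * bessel_entire (\<mu> + 1) (t\<^sup>2) + t\<^sup>2 * bessel_entire (\<mu> + 2) (t\<^sup>2)\<close> for
  \<open>t powr (-q)\<close> times the derivative of \<open>t powr q * g t\<close> differ only in the coefficient of one
  positive term, and \<open>K_const \<mu> q\<close> is exactly the factor that makes up for this
  (\<open>power_weight_pointwise_bound\<close>). As \<open>w t * t powr (-q)\<close> is at most its value at \<open>x\<close>, the integral
  of \<open>w * h\<close> over \<open>(0, x)\<close> is at most \<open>K_const \<mu> q * w x * g x\<close> for every \<open>x > 0\<close>. Restoring the
  factor \<open>exp (- \<gamma> x)\<close> costs \<open>exp (\<gamma> x)\<close>, which is harmless as long as \<open>x\<close> does not exceed
  \<open>a = 2 (\<mu> + 2) \<theta> / (1 - \<theta>)\<close>.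

  Beyond \<open>a\<close> the ratio of consecutive Bessel functions is close to 1. Termwise AM-GM gives
  \<open>bessel_I (\<nu> + 1) \<le> bessel_I \<nu>\<close> for \<open>\<nu> \<ge> 0\<close> (\<open>bessel_entire_order_antimono\<close>), and the recurrence turns this
  into a lower bound \<open>t / (t + 2 (\<nu> + 1))\<close> for the ratio at order \<open>\<nu> > -1\<close>
  (\<open>bessel_entire_ratio_bound\<close>). At order \<open>\<mu> + 1\<close> and \<open>t \<ge> a\<close> this bound is at least \<open>\<theta>\<close>, so that
  \<open>g\<close> grows at least like \<open>exp (\<theta> t)\<close> and \<open>exp (- \<gamma> t) * g t\<close> has a derivative of at least
  \<open>\<theta> - \<gamma>\<close> times itself; at order \<open>\<mu>\<close> it gives \<open>h \<le> (\<mu> + 1 + \<theta>) / ((\<mu> + 2) \<theta>) * g\<close>. As \<open>w\<close> is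
  nondecreasing, the integral over \<open>(a, x)\<close> is bounded by a constant times \<open>w x\<close> times the increment of
  \<open>exp (- \<gamma> t) * g t\<close>. Adding the bound for \<open>(0, a)\<close> cancels the contribution of the left end point.
\<close>

section \<open>The entire part of the modified Bessel function\<close>

definition bessel_coeff :: "real \<Rightarrow> nat \<Rightarrow> real" where
  "bessel_coeff \<nu> k = (1 / 2) powr (2 * real k + \<nu>) / (fact k * Gamma (real k + \<nu> + 1))"

text \<open>
  Up to the factor \<open>2 powr (-\<nu>) / Gamma (\<nu> + 1)\<close> this is the hypergeometric function
  \<open>0F1(; \<nu> + 1; y / 4)\<close>. Taking \<open>y = t\<^sup>2\<close> as the variable leaves an ordinary power series, free of the
  real power \<open>t powr \<nu>\<close> that would obstruct termwise differentiation at the origin.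
\<close>

definition bessel_entire :: "real \<Rightarrow> real \<Rightarrow> real" where
  "bessel_entire \<nu> y = (\<Sum>k. bessel_coeff \<nu> k * y ^ k)"

lemma bessel_coeff_pos: "\<nu> > -1 \<Longrightarrow> bessel_coeff \<nu> k > 0"
  unfolding bessel_coeff_def by (auto intro!: divide_pos_pos mult_pos_pos Gamma_real_pos)

text \<open>
  Up to a factor 2, raising the order differentiates the series, because the factor \<open>Gamma\<close> is the same
  for \<open>(\<nu> + 1, k)\<close> and \<open>(\<nu>, k + 1)\<close>. Together with the functional equation of \<open>Gamma\<close>, which gives
  \<open>bessel_coeff_shift\<close>, this yields all recurrences and inequalities between the series.
\<close>

lemma bessel_coeff_Suc:
  "bessel_coeff (\<nu> + 1) k = 2 * (real k + 1) * bessel_coeff \<nu> (Suc k)"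
proof -
  have e: "2 * real (Suc k) + \<nu> = (2 * real k + (\<nu> + 1)) + 1" by simp
  have p: "(1 / 2 :: real) powr (2 * real (Suc k) + \<nu>) = (1/2) powr (2 * real k + (\<nu> + 1)) / 2"
    unfolding e by (subst powr_add) simp
  have g: "real (Suc k) + \<nu> + 1 = real k + (\<nu> + 1) + 1" by simp
  show ?thesis
    unfolding bessel_coeff_def p g fact_Suc by (simp add: divide_simps)
qed

lemma bessel_coeff_shift:
  assumes "\<nu> > -1"
  shows "bessel_coeff \<nu> k = 2 * (real k + \<nu> + 1) * bessel_coeff (\<nu> + 1) k"
proof -
  have e: "2 * real k + (\<nu> + 1) = (2 * real k + \<nu>) + 1" by simp
  have p: "(1 / 2 :: real) powr (2 * real k + (\<nu> + 1)) = (1/2) powr (2 * real k + \<nu>) / 2"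
    unfolding e by (subst powr_add) simp
  have pos: "real k + \<nu> + 1 > 0" using assms by simp
  have g: "Gamma (real k + (\<nu> + 1) + 1) = (real k + \<nu> + 1) * Gamma (real k + \<nu> + 1)"
  proof -
    have "Gamma ((real k + \<nu> + 1) + 1) = (real k + \<nu> + 1) * Gamma (real k + \<nu> + 1)"
      by (rule Gamma_plus1) (use pos in \<open>auto elim!: nonpos_Ints_cases\<close>)
    thus ?thesis by (simp add: algebra_simps)
  qed
  show ?thesis
    unfolding bessel_coeff_def p g using pos by (simp add: divide_simps)
qed

lemma summable_bessel_entire:
  assumes "\<nu> > -1"
  shows "summable (\<lambda>k. bessel_coeff \<nu> k * y ^ k)"
proof (rule summable_ratio_test[of "1/2" "nat \<lceil>\<bar>y\<bar>\<rceil> + 1"])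
  fix n assume n: "nat \<lceil>\<bar>y\<bar>\<rceil> + 1 \<le> n"
  define d where "d = bessel_coeff \<nu> (Suc n)"
  have d: "d > 0" unfolding d_def by (rule bessel_coeff_pos[OF assms])
  have y: "\<bar>y\<bar> \<le> real n" using n by linarith
  have n1: "real n \<ge> 1" using n by linarith
  \<comment> \<open>Consecutive coefficients have the quotient \<open>4 (n + \<nu> + 1) (n + 1)\<close>; as \<open>n \<ge> 1\<close>, its first
      bracket exceeds 1 although \<open>\<nu>\<close> may be negative.\<close>
  define A where "A = 4 * ((real n + \<nu> + 1) * (real n + 1))"
  have c: "bessel_coeff \<nu> n = A * d"
    unfolding bessel_coeff_shift[OF assms, of n] bessel_coeff_Suc d_def A_def by (simp add: algebra_simps)
  have "2 * \<bar>y\<bar> \<le> 4 * (1 * (real n + 1))" using y by simp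
  also have "\<dots> \<le> A"
    unfolding A_def using n1 assms by (intro mult_left_mono mult_right_mono) auto
  finally have A: "\<bar>y\<bar> \<le> A / 2" by simp
  hence "d * \<bar>y\<bar> ^ n * \<bar>y\<bar> \<le> d * \<bar>y\<bar> ^ n * (A / 2)"
    using d by (intro mult_left_mono) auto
  moreover have "A \<ge> 0" using A by linarith
  ultimately show "norm (bessel_coeff \<nu> (Suc n) * y ^ Suc n) \<le> 1 / 2 * norm (bessel_coeff \<nu> n * y ^ n)"
    using d by (simp add: abs_mult power_abs c mult_ac flip: d_def)
qed simp

lemma bessel_entire_pos:
  assumes "\<nu> > -1" "y \<ge> 0"
  shows "bessel_entire \<nu> y > 0"
proof -
  have "(\<Sum>k\<in>{0}. bessel_coeff \<nu> k * y ^ k) \<le> bessel_entire \<nu> y"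
    unfolding bessel_entire_def
    by (rule sum_le_suminf[OF summable_bessel_entire])
       (use assms bessel_coeff_pos[OF assms(1)] in \<open>auto intro!: mult_nonneg_nonneg intro: less_imp_le\<close>)
  thus ?thesis using bessel_coeff_pos[OF assms(1), of 0] by simp
qed

lemma DERIV_bessel_entire:
  assumes "\<nu> > -1"
  shows "(bessel_entire \<nu> has_real_derivative bessel_entire (\<nu> + 1) y / 2) (at y)"
proof -
  have d: "diffs (bessel_coeff \<nu>) k = bessel_coeff (\<nu> + 1) k / 2" for k
    by (simp add: diffs_def bessel_coeff_Suc)
  have "((\<lambda>x. \<Sum>n. bessel_coeff \<nu> n * x ^ n) has_real_derivative
          (\<Sum>n. diffs (bessel_coeff \<nu>) n * y ^ n)) (at y)"
    by (rule termdiffs_strong_converges_everywhere) (rule summable_bessel_entire[OF assms])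
  moreover have "(\<Sum>n. diffs (bessel_coeff \<nu>) n * y ^ n) = bessel_entire (\<nu> + 1) y / 2"
    unfolding bessel_entire_def d
    using suminf_divide[OF summable_bessel_entire, of "\<nu> + 1" y 2] assms by simp
  moreover have "(\<lambda>x. \<Sum>n. bessel_coeff \<nu> n * x ^ n) = bessel_entire \<nu>"
    by (simp add: bessel_entire_def fun_eq_iff)
  ultimately show ?thesis by simp
qed

lemma DERIV_bessel_entire_square:
  assumes "\<nu> > -1"
  shows "((\<lambda>t. bessel_entire \<nu> (t\<^sup>2)) has_real_derivative t * bessel_entire (\<nu> + 1) (t\<^sup>2)) (at t)"
proof -
  have "((\<lambda>t. t\<^sup>2) has_real_derivative 2 * t) (at t)"
    by (auto intro!: derivative_eq_intros)
  from DERIV_chain2[OF DERIV_bessel_entire[OF assms] this] show ?thesis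
    by (simp add: mult.commute)
qed

lemma bessel_I_eq:
  assumes "\<nu> > -1" "t > 0"
  shows "bessel_I \<nu> t = t powr \<nu> * bessel_entire \<nu> (t\<^sup>2)"
proof -
  have "(t / 2) powr (2 * real k + \<nu>) / (fact k * Gamma (real k + \<nu> + 1)) =
      t powr \<nu> * (bessel_coeff \<nu> k * (t\<^sup>2) ^ k)" for k
  proof -
    have "(t / 2) powr (2 * real k + \<nu>) = t powr (2 * real k + \<nu>) * (1/2) powr (2 * real k + \<nu>)"
      using assms by (simp add: powr_mult[symmetric])
    also have "t powr (2 * real k + \<nu>) = t powr \<nu> * (t\<^sup>2) ^ k"
      using assms powr_realpow[of t "2 * k"] by (simp add: powr_add power_mult)
    finally show ?thesis by (simp add: bessel_coeff_def)
  qed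
  thus ?thesis
    unfolding bessel_I_def bessel_entire_def
    using suminf_mult[OF summable_bessel_entire[OF assms(1)]] by simp
qed

section \<open>The three-term recurrence and bounds on ratios\<close>

text \<open>
  This is the classical \<open>bessel_I \<nu> t - bessel_I (\<nu> + 2) t = (2 (\<nu> + 1) / t) * bessel_I (\<nu> + 1) t\<close>. On
  coefficients: the factor \<open>2 (k + \<nu> + 1)\<close> from \<open>bessel_coeff_shift\<close> splits into \<open>2 (\<nu> + 1)\<close> and
  \<open>2 k\<close>, and the latter produces the series of order \<open>\<nu> + 2\<close> shifted by one place.
\<close>

lemma bessel_entire_recurrence:
  assumes "\<nu> > -1"
  shows "bessel_entire \<nu> y = 2 * (\<nu> + 1) * bessel_entire (\<nu> + 1) y + y * bessel_entire (\<nu> + 2) y"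
proof -
  have s1: "(\<lambda>k. bessel_coeff (\<nu> + 1) k * y ^ k) sums bessel_entire (\<nu> + 1) y"
    and s2: "(\<lambda>k. bessel_coeff (\<nu> + 2) k * y ^ k) sums bessel_entire (\<nu> + 2) y"
    unfolding bessel_entire_def using assms by (auto intro!: summable_sums summable_bessel_entire)
  have t: "y * (bessel_coeff (\<nu> + 2) k * y ^ k) = 2 * real (Suc k) * bessel_coeff (\<nu> + 1) (Suc k) * y ^ Suc k" for k
    using bessel_coeff_Suc[of "\<nu> + 1" k] by (simp add: add.assoc algebra_simps)
  have "(\<lambda>k. 2 * real (Suc k) * bessel_coeff (\<nu> + 1) (Suc k) * y ^ Suc k) sums (y * bessel_entire (\<nu> + 2) y)"
    using sums_mult[OF s2, of y] unfolding t .
  \<comment> \<open>The summand at index 0 vanishes, so the shifted series may start there.\<close>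
  hence "(\<lambda>k. 2 * real k * bessel_coeff (\<nu> + 1) k * y ^ k) sums (y * bessel_entire (\<nu> + 2) y)"
    by (subst (asm) sums_Suc_iff) simp
  from sums_add[OF sums_mult[OF s1, of "2 * (\<nu> + 1)"] this]
  have "(\<lambda>k. bessel_coeff \<nu> k * y ^ k) sums
      (2 * (\<nu> + 1) * bessel_entire (\<nu> + 1) y + y * bessel_entire (\<nu> + 2) y)"
    by (simp add: bessel_coeff_shift[OF assms] algebra_simps)
  thus ?thesis unfolding bessel_entire_def by (simp add: sums_iff)
qed

text \<open>
  The left-hand side is a series in odd powers of \<open>t\<close>, the right-hand side one in even powers. Each odd term is at most the
  arithmetic mean of the two neighbouring even terms, since \<open>\<nu> \<ge> 0\<close> makes the product of their coefficients
  large enough for AM-GM. Summation uses every even term at most twice with weight one half.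
  For \<open>t > 0\<close> the result amounts to \<open>bessel_I (\<nu> + 1) t \<le> bessel_I \<nu> t\<close>.
\<close>

lemma bessel_entire_order_antimono:
  assumes "\<nu> \<ge> 0"
  shows "t * bessel_entire (\<nu> + 1) (t\<^sup>2) \<le> bessel_entire \<nu> (t\<^sup>2)"
proof -
  have \<nu>: "\<nu> > -1" "\<nu> + 1 > -1" using assms by auto
  have s: "(\<lambda>k. bessel_coeff \<nu> k * (t\<^sup>2) ^ k) sums bessel_entire \<nu> (t\<^sup>2)"
    and s1: "(\<lambda>k. bessel_coeff (\<nu> + 1) k * (t\<^sup>2) ^ k) sums bessel_entire (\<nu> + 1) (t\<^sup>2)"
    unfolding bessel_entire_def using \<nu> by (auto intro!: summable_sums summable_bessel_entire)
  have s': "(\<lambda>k. bessel_coeff \<nu> (Suc k) * (t\<^sup>2) ^ Suc k) sums (bessel_entire \<nu> (t\<^sup>2) - bessel_coeff \<nu> 0)"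
    using s by (subst sums_Suc_iff) simp
  have le: "t * (bessel_coeff (\<nu> + 1) k * (t\<^sup>2) ^ k) \<le>
      (bessel_coeff \<nu> k * (t\<^sup>2) ^ k + bessel_coeff \<nu> (Suc k) * (t\<^sup>2) ^ Suc k) / 2" for k
  proof -
    define d where "d = bessel_coeff \<nu> (Suc k)"
    have d: "d > 0" unfolding d_def by (rule bessel_coeff_pos[OF \<nu>(1)])
    define n where "n = real k + 1"
    have n: "n > 0" by (simp add: n_def)
    have c1: "bessel_coeff (\<nu> + 1) k = 2 * n * d"
      by (simp add: bessel_coeff_Suc d_def n_def)
    have c0: "bessel_coeff \<nu> k = 4 * (n + \<nu>) * n * d"
      unfolding bessel_coeff_shift[OF \<nu>(1)] c1 by (simp add: n_def algebra_simps)
    have "4 * n * t \<le> 4 * n\<^sup>2 + t\<^sup>2"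
      using sum_squares_ge_zero[of "2 * n - t" 0] by (simp add: power2_eq_square algebra_simps)
    also have "\<dots> \<le> 4 * (n + \<nu>) * n + t\<^sup>2" using n assms by (simp add: power2_eq_square algebra_simps)
    finally have "(4 * n * t) * (d * (t\<^sup>2) ^ k) \<le> (4 * (n + \<nu>) * n + t\<^sup>2) * (d * (t\<^sup>2) ^ k)"
      using d by (intro mult_right_mono) auto
    thus ?thesis unfolding c1 c0 d_def[symmetric] by (simp add: algebra_simps)
  qed
  have "t * bessel_entire (\<nu> + 1) (t\<^sup>2) \<le> (bessel_entire \<nu> (t\<^sup>2) + (bessel_entire \<nu> (t\<^sup>2) - bessel_coeff \<nu> 0)) / 2"
    by (rule sums_le[OF le sums_mult[OF s1] sums_divide[OF sums_add[OF s s']]])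
  thus ?thesis using bessel_coeff_pos[OF \<nu>(1), of 0] by (simp add: field_simps)
qed

text \<open>
  Inserting \<open>bessel_I (\<nu> + 2) \<le> bessel_I (\<nu> + 1)\<close> in the recurrence bounds the ratio from the other
  side: \<open>bessel_I (\<nu> + 1) t\<close> is at least \<open>t / (t + 2 (\<nu> + 1)) * bessel_I \<nu> t\<close>. Monotonicity is
  applied at order \<open>\<nu> + 1 > 0\<close>, which is why \<open>\<nu> > -1\<close> suffices.
\<close>

lemma bessel_entire_ratio_bound:
  assumes "\<nu> > -1" "t \<ge> 0"
  shows "bessel_entire \<nu> (t\<^sup>2) \<le> (2 * (\<nu> + 1) + t) * bessel_entire (\<nu> + 1) (t\<^sup>2)"
proof -
  have "t * (t * bessel_entire (\<nu> + 2) (t\<^sup>2)) \<le> t * bessel_entire (\<nu> + 1) (t\<^sup>2)"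
    using bessel_entire_order_antimono[of "\<nu> + 1" t] assms
    by (intro mult_left_mono) (simp_all add: add.assoc)
  thus ?thesis
    by (subst bessel_entire_recurrence[OF assms(1)]) (simp add: power2_eq_square algebra_simps)
qed

section \<open>Integrals dominated by a derivative\<close>

text \<open>
  The dominating derivative is required on the open interval only, because the primitives of
  interest contain \<open>t powr (q + 1)\<close>, which for \<open>q = 0\<close> is not differentiable at the origin. Integrability of \<open>g\<close> comes
  from the fundamental theorem for the gauge integral, and it passes to \<open>f\<close> by domination.
\<close>

lemma set_integral_le_primitive:
  fixes f G g :: "real \<Rightarrow> real"
  assumes "a \<le> b" and cont: "continuous_on {a..b} G"
    and der: "\<And>t. a < t \<Longrightarrow> t < b \<Longrightarrow> (G has_real_derivative g t) (at t)"
    and meas: "f \<in> borel_measurable (lebesgue_on {a<..<b})"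
    and f0: "\<And>t. a < t \<Longrightarrow> t < b \<Longrightarrow> 0 \<le> f t"
    and fg: "\<And>t. a < t \<Longrightarrow> t < b \<Longrightarrow> f t \<le> g t"
  shows "set_integrable lebesgue {a<..<b} f"
    and "set_lebesgue_integral lebesgue {a<..<b} f \<le> G b - G a"
proof -
  have "(g has_integral (G b - G a)) {a..b}"
    using assms by (intro fundamental_theorem_of_calculus_interior)
      (auto simp: has_real_derivative_iff_has_vector_derivative)
  hence g: "(g has_integral (G b - G a)) {a<..<b}"
    by (simp add: has_integral_Icc_iff_Ioo)
  have fg': "norm (f t) \<le> g t" if "t \<in> {a<..<b}" for t using f0[of t] fg[of t] that by auto
  have ai: "f absolutely_integrable_on {a<..<b}"
    by (rule measurable_bounded_by_integrable_imp_absolutely_integrable[OF meas])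
       (use g fg' in auto)
  thus "set_integrable lebesgue {a<..<b} f" .
  have "set_lebesgue_integral lebesgue {a<..<b} f = integral {a<..<b} f"
    by (rule set_lebesgue_integral_eq_integral(2)[OF ai])
  also have "\<dots> \<le> integral {a<..<b} g"
    by (rule integral_le) (use ai g fg in \<open>auto intro: set_lebesgue_integral_eq_integral(1)\<close>)
  also have "\<dots> = G b - G a" using g by (rule integral_unique)
  finally show "set_lebesgue_integral lebesgue {a<..<b} f \<le> G b - G a" .
qed


lemma set_integral_split_Ioo:
  fixes f :: "real \<Rightarrow> real"
  assumes "a \<le> b" "b \<le> c" "set_integrable lebesgue {a<..<c} f"
  shows "set_lebesgue_integral lebesgue {a<..<c} f =
     set_lebesgue_integral lebesgue {a<..<b} f + set_lebesgue_integral lebesgue {b<..<c} f"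
proof -
  have i: "set_integrable lebesgue {a<..<b} f" "set_integrable lebesgue {b<..<c} f"
    using assms by (auto intro: set_integrable_subset)
  have "f integrable_on {a..c}"
    using set_lebesgue_integral_eq_integral(1)[OF assms(3)] by (simp add: integrable_on_Icc_iff_Ioo)
  from Henstock_Kurzweil_Integration.integral_combine[OF assms(1,2) this] show ?thesis
    using i assms(3) by (simp add: set_lebesgue_integral_eq_integral integral_open_interval_real)
qed

section \<open>Upper power weights and the bound near the origin\<close>

lemma upper_power_weight_mono:
  assumes "upper_power_weight q w" "q \<ge> 0" "0 < t" "t \<le> x"
  shows "w t \<le> w x"
proof -
  have m: "w t * t powr (- q) \<le> w x * x powr (- q)"
    using assms by (auto simp: upper_power_weight_def mono_on_def)
  have "w x \<ge> 0" using assms by (auto simp: upper_power_weight_def intro: less_imp_le)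
  have "w t = (w t * t powr (- q)) * t powr q"
    using assms by (simp add: powr_minus)
  also have "\<dots> \<le> (w x * x powr (- q)) * x powr q"
    using assms \<open>w x \<ge> 0\<close> by (intro mult_mono[OF m] powr_mono2) auto
  also have "\<dots> = w x" using assms by (simp add: powr_minus)
  finally show ?thesis .
qed

lemma continuous_on_bessel_entire_square:
  assumes "\<nu> > -1"
  shows "continuous_on S (\<lambda>t. bessel_entire \<nu> (t\<^sup>2))"
  by (rule DERIV_continuous_on[OF DERIV_subset[OF DERIV_bessel_entire_square[OF assms]]]) simp

lemma measurable_weighted_integrand:
  assumes "\<nu> > -1" "upper_power_weight q w" "a \<ge> 0"
  shows "(\<lambda>t. exp (- \<gamma> * t) * w t * bessel_entire \<nu> (t\<^sup>2)) \<in> borel_measurable (lebesgue_on {a<..<b})"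
proof -
  have "w \<in> borel_measurable (lebesgue_on {a<..<b})"
    using assms by (auto simp: upper_power_weight_def intro: measurable_restrict_mono)
  moreover have "(\<lambda>t. exp (- \<gamma> * t)) \<in> borel_measurable (lebesgue_on {a<..<b})"
    by (rule continuous_imp_measurable_on_sets_lebesgue) (auto intro!: continuous_intros)
  moreover have "(\<lambda>t. bessel_entire \<nu> (t\<^sup>2)) \<in> borel_measurable (lebesgue_on {a<..<b})"
    by (rule continuous_imp_measurable_on_sets_lebesgue)
       (auto intro!: continuous_on_bessel_entire_square assms)
  ultimately show ?thesis by (intro borel_measurable_times)
qed

text \<open>
  The bracket on the right is \<open>t powr (-q)\<close> times the derivative of
  \<open>t powr (q + 1) * bessel_entire (\<mu> + 1) (t\<^sup>2)\<close>. By the recurrence, the left-hand side is the same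
  combination with \<open>2 (\<mu> + 1)\<close> in place of \<open>q + 1\<close>, so the two requirements on the constant are
  \<open>2 (\<mu> + 1) / (q + 1) \<le> K_const \<mu> q\<close> and \<open>1 \<le> K_const \<mu> q\<close>.
\<close>

lemma power_weight_pointwise_bound:
  assumes "\<mu> > -1" "q \<ge> 0"
  shows "bessel_entire \<mu> (t\<^sup>2) \<le> K_const \<mu> q *
           ((q + 1) * bessel_entire (\<mu> + 1) (t\<^sup>2) + t\<^sup>2 * bessel_entire (\<mu> + 2) (t\<^sup>2))"
proof -
  have p: "bessel_entire (\<mu> + 1) (t\<^sup>2) > 0" "bessel_entire (\<mu> + 2) (t\<^sup>2) > 0"
    using assms by (auto intro!: bessel_entire_pos)
  have "2 * (\<mu> + 1) / (q + 1) \<le> K_const \<mu> q" "1 \<le> K_const \<mu> q" by (auto simp: K_const_def)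
  hence K: "2 * (\<mu> + 1) \<le> K_const \<mu> q * (q + 1)" "1 \<le> K_const \<mu> q"
    using assms by (auto simp: pos_divide_le_eq)
  have "2 * (\<mu> + 1) * bessel_entire (\<mu> + 1) (t\<^sup>2) \<le> K_const \<mu> q * (q + 1) * bessel_entire (\<mu> + 1) (t\<^sup>2)"
    using K p by (intro mult_right_mono) auto
  moreover have "1 * (t\<^sup>2 * bessel_entire (\<mu> + 2) (t\<^sup>2)) \<le> K_const \<mu> q * (t\<^sup>2 * bessel_entire (\<mu> + 2) (t\<^sup>2))"
    using K p by (intro mult_right_mono) auto
  ultimately show ?thesis
    by (subst bessel_entire_recurrence[OF assms(1)]) (simp add: algebra_simps)
qed

text \<open>
  The weight is controlled by \<open>w t * t powr (-q) \<le> w x * x powr (-q)\<close>, after which the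
  pointwise bound makes a constant multiple of \<open>t powr (q + 1) * bessel_entire (\<mu> + 1) (t\<^sup>2)\<close> a
  suitable primitive. It vanishes at 0 since \<open>q + 1 > 0\<close>. The decaying exponential is bounded by 1, which
  is good enough for small \<open>x\<close>.
\<close>

lemma weighted_integral_from_zero:
  assumes "\<mu> > -1" "q \<ge> 0" "\<gamma> \<ge> 0" "upper_power_weight q w" "x > 0"
  defines "f \<equiv> \<lambda>t. exp (- \<gamma> * t) * w t * bessel_entire \<mu> (t\<^sup>2)"
  shows "set_integrable lebesgue {0<..<x} f"
    and "set_lebesgue_integral lebesgue {0<..<x} f \<le> K_const \<mu> q * w x * (x * bessel_entire (\<mu> + 1) (x\<^sup>2))"
proof -
  define G where "G = (\<lambda>t. K_const \<mu> q * (w x * x powr (- q)) * (t powr (q + 1) * bessel_entire (\<mu> + 1) (t\<^sup>2)))"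
  define g where "g = (\<lambda>t. K_const \<mu> q * (w x * x powr (- q)) * (t powr q *
    ((q + 1) * bessel_entire (\<mu> + 1) (t\<^sup>2) + t\<^sup>2 * bessel_entire (\<mu> + 2) (t\<^sup>2))))"
  have w: "w t > 0" if "t > 0" for t using assms that by (auto simp: upper_power_weight_def)
  have E: "bessel_entire \<mu> (t\<^sup>2) > 0" for t using assms by (auto intro!: bessel_entire_pos)
  have \<mu>: "\<mu> + 1 > -1" using assms by simp
  have cont: "continuous_on {0..x} G"
    unfolding G_def using assms
    by (intro continuous_on_mult continuous_on_const continuous_on_id continuous_on_powr'
          continuous_on_bessel_entire_square) auto
  have der: "(G has_real_derivative g t) (at t)" if "0 < t" "t < x" for t
  proof -
    have p: "((\<lambda>t. t powr (q + 1)) has_real_derivative (q + 1) * t powr q) (at t)"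
      using has_real_derivative_powr[of t "q + 1"] that by simp
    have d: "((\<lambda>t. bessel_entire (\<mu> + 1) (t\<^sup>2)) has_real_derivative
        t * bessel_entire (\<mu> + 2) (t\<^sup>2)) (at t)"
      using DERIV_bessel_entire_square[OF \<mu>, of t] by (simp add: add.assoc)
    show ?thesis
      unfolding G_def g_def
      by (rule DERIV_cong[OF DERIV_cmult[OF DERIV_mult[OF p d]]])
         (use that in \<open>simp add: powr_add power2_eq_square algebra_simps\<close>)
  qed
  have f0: "0 \<le> f t" if "0 < t" "t < x" for t
    using w[OF that(1)] E[of t] by (simp add: f_def)
  have fg: "f t \<le> g t" if "0 < t" "t < x" for t
  proof -
    have "exp (- \<gamma> * t) * (w t * bessel_entire \<mu> (t\<^sup>2)) \<le> 1 * (w t * bessel_entire \<mu> (t\<^sup>2))"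
      using w[OF that(1)] E[of t] that assms by (intro mult_right_mono) auto
    hence "f t \<le> w t * bessel_entire \<mu> (t\<^sup>2)" by (simp add: f_def)
    also have "\<dots> = (w t * t powr (- q)) * (t powr q * bessel_entire \<mu> (t\<^sup>2))"
      using that by (simp add: powr_minus)
    also have "\<dots> \<le> (w x * x powr (- q)) * (t powr q * (K_const \<mu> q *
        ((q + 1) * bessel_entire (\<mu> + 1) (t\<^sup>2) + t\<^sup>2 * bessel_entire (\<mu> + 2) (t\<^sup>2))))"
    proof (rule mult_mono)
      show "w t * t powr (- q) \<le> w x * x powr (- q)"
        using that assms by (auto simp: upper_power_weight_def mono_on_def)
    qed (use assms w[of x] E[of t] power_weight_pointwise_bound[OF assms(1,2), of t]
          in \<open>auto intro!: mult_left_mono\<close>)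
    also have "\<dots> = g t" by (simp add: g_def algebra_simps)
    finally show ?thesis .
  qed
  have meas: "f \<in> borel_measurable (lebesgue_on {0<..<x})"
    unfolding f_def by (rule measurable_weighted_integrand) (use assms in auto)
  have "0 \<le> x" using assms by simp
  note * = set_integral_le_primitive[OF this cont der meas f0 fg]
  show "set_integrable lebesgue {0<..<x} f" by (rule *(1))
  have "G x = K_const \<mu> q * w x * (x * bessel_entire (\<mu> + 1) (x\<^sup>2))" "G 0 = 0"
    using assms by (simp_all add: G_def powr_add powr_minus)
  with *(2) show "set_lebesgue_integral lebesgue {0<..<x} f \<le>
      K_const \<mu> q * w x * (x * bessel_entire (\<mu> + 1) (x\<^sup>2))" by simp
qed

section \<open>The bound away from the origin\<close>

text \<open>
  The threshold for \<open>a\<close> says that \<open>t / (t + 2 (\<mu> + 2)) \<ge> \<theta>\<close> for \<open>t \<ge> a\<close>. It serves twice: at order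
  \<open>\<mu> + 1\<close> it gives the exponential growth of \<open>t * bessel_entire (\<mu> + 1) (t\<^sup>2)\<close> at rate \<open>\<theta>\<close>, which
  outweighs the factor \<open>exp (- \<gamma> * t)\<close>; at order \<open>\<mu>\<close> it controls the integrand by that function.
  The lower end point is kept on the right-hand side so that the bound on \<open>(0, a)\<close> can be absorbed.
\<close>

lemma weighted_integral_tail:
  assumes "\<mu> > -1" "q \<ge> 0" "\<gamma> > 0" "\<gamma> < \<theta>" "\<theta> < 1" "upper_power_weight q w"
    and a: "2 * (\<mu> + 2) * \<theta> / (1 - \<theta>) \<le> a" and "a \<le> x"
  defines "f \<equiv> \<lambda>t. exp (- \<gamma> * t) * w t * bessel_entire \<mu> (t\<^sup>2)"
  defines "C \<equiv> (\<mu> + 1 + \<theta>) / ((\<mu> + 2) * \<theta> * (\<theta> - \<gamma>))"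
  shows "set_lebesgue_integral lebesgue {a<..<x} f \<le> C * w x *
     (exp (- \<gamma> * x) * (x * bessel_entire (\<mu> + 1) (x\<^sup>2)) - exp (- \<gamma> * a) * (a * bessel_entire (\<mu> + 1) (a\<^sup>2)))"
proof -
  define G where "G = (\<lambda>t. C * w x * (exp (- \<gamma> * t) * (t * bessel_entire (\<mu> + 1) (t\<^sup>2))))"
  define g where "g = (\<lambda>t. C * w x * (exp (- \<gamma> * t) * (bessel_entire (\<mu> + 1) (t\<^sup>2) +
     t\<^sup>2 * bessel_entire (\<mu> + 2) (t\<^sup>2) - \<gamma> * (t * bessel_entire (\<mu> + 1) (t\<^sup>2)))))"
  have \<theta>: "\<theta> > 0" "1 - \<theta> > 0" "\<theta> - \<gamma> > 0" using assms by auto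
  have \<mu>: "\<mu> + 1 > -1" "\<mu> + 2 > 0" using assms by auto
  have "0 < 2 * (\<mu> + 2) * \<theta> / (1 - \<theta>)" using \<theta> \<mu> by auto
  hence a0: "a > 0" using a by linarith
  have C: "C > 0" unfolding C_def using assms \<theta> by (intro divide_pos_pos mult_pos_pos) auto
  have w: "w t > 0" if "t > 0" for t using assms that by (auto simp: upper_power_weight_def)
  have E: "bessel_entire \<mu> (t\<^sup>2) > 0" "bessel_entire (\<mu> + 1) (t\<^sup>2) > 0" "bessel_entire (\<mu> + 2) (t\<^sup>2) > 0" for t
    using assms by (auto intro!: bessel_entire_pos)
  have cont: "continuous_on {a..x} G"
    unfolding G_def using \<mu> by (intro continuous_intros continuous_on_bessel_entire_square) auto
  have der: "(G has_real_derivative g t) (at t)" for t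
  proof -
    have e: "((\<lambda>t. exp (- \<gamma> * t)) has_real_derivative - \<gamma> * exp (- \<gamma> * t)) (at t)"
      by (auto intro!: derivative_eq_intros)
    have d: "((\<lambda>t. bessel_entire (\<mu> + 1) (t\<^sup>2)) has_real_derivative
        t * bessel_entire (\<mu> + 2) (t\<^sup>2)) (at t)"
      using DERIV_bessel_entire_square[OF \<mu>(1), of t] by (simp add: add.assoc)
    show ?thesis
      unfolding G_def g_def
      by (rule DERIV_cong[OF DERIV_cmult[OF DERIV_mult[OF e DERIV_mult[OF DERIV_ident d]]]])
         (simp add: power2_eq_square algebra_simps)
  qed
  have f0: "0 \<le> f t" if "a < t" "t < x" for t
    using w[of t] a0 that E[of t] by (simp add: f_def)
  have fg: "f t \<le> g t" if t: "a < t" "t < x" for t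
  proof -
    have t0: "t > 0" using a0 t by simp
    have ta: "2 * (\<mu> + 2) * \<theta> \<le> (1 - \<theta>) * t"
    proof -
      have "2 * (\<mu> + 2) * \<theta> / (1 - \<theta>) \<le> t" using a t by linarith
      thus ?thesis using \<theta> by (simp add: pos_divide_le_eq mult.commute)
    qed
    have "\<theta> * bessel_entire (\<mu> + 1) (t\<^sup>2) \<le> \<theta> * ((2 * (\<mu> + 2) + t) * bessel_entire (\<mu> + 2) (t\<^sup>2))"
      using bessel_entire_ratio_bound[OF \<mu>(1), of t] \<theta> t0 by (intro mult_left_mono) (auto simp: add.assoc)
    also have "\<dots> = (2 * (\<mu> + 2) * \<theta> + \<theta> * t) * bessel_entire (\<mu> + 2) (t\<^sup>2)" by (simp add: algebra_simps)
    also have "\<dots> \<le> t * bessel_entire (\<mu> + 2) (t\<^sup>2)"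
      using ta E(3)[of t] by (intro mult_right_mono) (auto simp: algebra_simps)
    finally have "t * (\<theta> * bessel_entire (\<mu> + 1) (t\<^sup>2)) \<le> t * (t * bessel_entire (\<mu> + 2) (t\<^sup>2))"
      using t0 by (intro mult_left_mono) auto
    \<comment> \<open>The right-hand side is \<open>exp (\<gamma> * t)\<close> times the derivative of
        \<open>exp (- \<gamma> * t) * (t * bessel_entire (\<mu> + 1) (t\<^sup>2))\<close>.\<close>
    hence growth: "(\<theta> - \<gamma>) * (t * bessel_entire (\<mu> + 1) (t\<^sup>2)) \<le> bessel_entire (\<mu> + 1) (t\<^sup>2) +
       t\<^sup>2 * bessel_entire (\<mu> + 2) (t\<^sup>2) - \<gamma> * (t * bessel_entire (\<mu> + 1) (t\<^sup>2))"
      using E(2)[of t] by (simp add: power2_eq_square algebra_simps)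
    have C1: "C * (\<theta> - \<gamma>) = (\<mu> + 1 + \<theta>) / ((\<mu> + 2) * \<theta>)"
      using \<theta> by (simp add: C_def)
    have "(2 * (\<mu> + 1) + t) * ((\<mu> + 2) * \<theta>) = (\<mu> + 1) * (2 * (\<mu> + 2) * \<theta>) + t * ((\<mu> + 2) * \<theta>)"
      by (simp add: algebra_simps)
    also have "\<dots> \<le> (\<mu> + 1) * ((1 - \<theta>) * t) + t * ((\<mu> + 2) * \<theta>)"
      using ta assms(1) by (intro add_right_mono mult_left_mono) auto
    also have "\<dots> = (\<mu> + 1 + \<theta>) * t" by (simp add: algebra_simps)
    finally have lin: "2 * (\<mu> + 1) + t \<le> C * (\<theta> - \<gamma>) * t"
      unfolding C1 using \<theta> \<mu> by (simp add: pos_le_divide_eq)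
    have "bessel_entire \<mu> (t\<^sup>2) \<le> (2 * (\<mu> + 1) + t) * bessel_entire (\<mu> + 1) (t\<^sup>2)"
      using bessel_entire_ratio_bound[OF assms(1), of t] t0 by simp
    also have "\<dots> \<le> (C * (\<theta> - \<gamma>) * t) * bessel_entire (\<mu> + 1) (t\<^sup>2)"
      using lin E(2)[of t] by (intro mult_right_mono) auto
    also have "\<dots> = C * ((\<theta> - \<gamma>) * (t * bessel_entire (\<mu> + 1) (t\<^sup>2)))" by simp
    also have "\<dots> \<le> C * (bessel_entire (\<mu> + 1) (t\<^sup>2) +
       t\<^sup>2 * bessel_entire (\<mu> + 2) (t\<^sup>2) - \<gamma> * (t * bessel_entire (\<mu> + 1) (t\<^sup>2)))"
      using growth C by (intro mult_left_mono) auto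
    finally have h: "bessel_entire \<mu> (t\<^sup>2) \<le> \<dots>" .
    have "w t * bessel_entire \<mu> (t\<^sup>2) \<le> w x * (C * (bessel_entire (\<mu> + 1) (t\<^sup>2) +
       t\<^sup>2 * bessel_entire (\<mu> + 2) (t\<^sup>2) - \<gamma> * (t * bessel_entire (\<mu> + 1) (t\<^sup>2))))"
      using upper_power_weight_mono[OF assms(6,2) t0, of x] t h w[OF t0] E(1)[of t]
      by (intro mult_mono) auto
    hence "exp (- \<gamma> * t) * (w t * bessel_entire \<mu> (t\<^sup>2)) \<le> exp (- \<gamma> * t) * \<dots>"
      by (intro mult_left_mono) auto
    thus ?thesis by (simp add: f_def g_def mult.assoc mult.left_commute)
  qed
  have meas: "f \<in> borel_measurable (lebesgue_on {a<..<x})"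
    unfolding f_def by (rule measurable_weighted_integrand) (use assms a0 in auto)
  show ?thesis
    using set_integral_le_primitive(2)[OF \<open>a \<le> x\<close> cont der meas f0 fg]
    by (simp add: G_def right_diff_distrib)
qed

section \<open>The weighted inequality\<close>

text \<open>
  Up to the threshold \<open>a\<close> the factor \<open>exp (\<gamma> * x)\<close>, lost by dropping the exponential under the integral,
  is at most \<open>exp (\<gamma> * a)\<close>, whence the first term of the maximum. Past \<open>a\<close>, the bound at \<open>a\<close> and the
  bound on the tail are added with the common constant \<open>M_const \<mu> q \<gamma> \<theta>\<close>: the terms at \<open>a\<close>
  cancel once \<open>w a\<close> has been replaced by \<open>w x\<close>.
\<close>

lemma weighted_integral_bound:
  assumes "\<mu> > -1" "q \<ge> 0" "\<gamma> > 0" "\<gamma> < \<theta>" "\<theta> < 1" "upper_power_weight q w" "x > 0"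
  defines "f \<equiv> \<lambda>t. exp (- \<gamma> * t) * w t * bessel_entire \<mu> (t\<^sup>2)"
  shows "set_lebesgue_integral lebesgue {0<..<x} f \<le>
     M_const \<mu> q \<gamma> \<theta> * (w x * (exp (- \<gamma> * x) * (x * bessel_entire (\<mu> + 1) (x\<^sup>2))))"
proof -
  define a where "a = 2 * (\<mu> + 2) * \<theta> / (1 - \<theta>)"
  define g where "g = (\<lambda>t. t * bessel_entire (\<mu> + 1) (t\<^sup>2))"
  define C where "C = (\<mu> + 1 + \<theta>) / ((\<mu> + 2) * \<theta> * (\<theta> - \<gamma>))"
  have a0: "a > 0" using assms by (auto simp: a_def)
  have g: "g t > 0" if "t > 0" for t
    using that assms by (auto simp: g_def intro!: mult_pos_pos bessel_entire_pos)
  have w: "w t > 0" if "t > 0" for t using assms that by (auto simp: upper_power_weight_def)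
  have K: "K_const \<mu> q \<ge> 1" by (simp add: K_const_def)
  have M: "K_const \<mu> q * exp (\<gamma> * a) \<le> M_const \<mu> q \<gamma> \<theta>" "C \<le> M_const \<mu> q \<gamma> \<theta>"
    by (simp_all add: M_const_def C_def a_def mult_ac)
  have small: "set_lebesgue_integral lebesgue {0<..<y} f \<le> M_const \<mu> q \<gamma> \<theta> * (w y * (exp (- \<gamma> * y) * g y))"
    if y: "0 < y" "y \<le> a" for y
  proof -
    have "set_lebesgue_integral lebesgue {0<..<y} f \<le> K_const \<mu> q * w y * g y"
      unfolding f_def g_def by (rule weighted_integral_from_zero(2)) (use assms y in auto)
    also have "\<dots> = (K_const \<mu> q * exp (\<gamma> * y)) * (w y * (exp (- \<gamma> * y) * g y))"
      by (simp add: exp_minus)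
    also have "\<dots> \<le> (K_const \<mu> q * exp (\<gamma> * a)) * (w y * (exp (- \<gamma> * y) * g y))"
      using y g[of y] w[of y] K assms by (intro mult_right_mono mult_left_mono) auto
    also have "\<dots> \<le> M_const \<mu> q \<gamma> \<theta> * (w y * (exp (- \<gamma> * y) * g y))"
      using y g[of y] w[of y] M by (intro mult_right_mono) auto
    finally show ?thesis .
  qed
  show ?thesis
  proof (cases "x \<le> a")
    case True
    thus ?thesis using small[of x] assms by (simp add: g_def)
  next
    case False
    define M where "M = M_const \<mu> q \<gamma> \<theta>"
    have CM: "C \<le> M" using M by (simp add: M_def)
    have "C > 0" unfolding C_def using assms by (intro divide_pos_pos mult_pos_pos) auto
    have tail: "set_lebesgue_integral lebesgue {a<..<x} f \<le>
       C * w x * (exp (- \<gamma> * x) * g x - exp (- \<gamma> * a) * g a)"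
      unfolding f_def g_def C_def by (rule weighted_integral_tail) (use assms False in \<open>auto simp: a_def\<close>)
    have wx: "w x > 0" "w a \<le> w x"
      using w assms upper_power_weight_mono[OF assms(6,2) a0, of x] False by auto
    \<comment> \<open>Enlarging the constant of the tail bound needs a nonnegative increment; the tail bound
        itself provides this, as its left-hand side is an integral of a nonnegative function.\<close>
    have incr: "0 \<le> exp (- \<gamma> * x) * g x - exp (- \<gamma> * a) * g a"
    proof -
      have "f t \<ge> 0" if "t \<in> {a<..<x}" for t
        using that a0 w[of t] assms bessel_entire_pos[of \<mu> "t\<^sup>2"] by (auto simp: f_def)
      hence "0 \<le> set_lebesgue_integral lebesgue {a<..<x} f"
        unfolding set_lebesgue_integral_def
        by (intro Bochner_Integration.integral_nonneg) (auto simp: indicator_def)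
      with tail have "0 \<le> (C * w x) * (exp (- \<gamma> * x) * g x - exp (- \<gamma> * a) * g a)" by simp
      moreover have "C * w x > 0" using \<open>C > 0\<close> wx by simp
      ultimately show ?thesis by (simp only: zero_le_mult_iff) linarith
    qed
    have "set_lebesgue_integral lebesgue {0<..<x} f =
        set_lebesgue_integral lebesgue {0<..<a} f + set_lebesgue_integral lebesgue {a<..<x} f"
    proof (rule set_integral_split_Ioo)
      show "set_integrable lebesgue {0<..<x} f"
        unfolding f_def by (rule weighted_integral_from_zero(1)) (use assms in auto)
    qed (use a0 False in auto)
    also have "\<dots> \<le> M * (w x * (exp (- \<gamma> * a) * g a)) + M * (w x * (exp (- \<gamma> * x) * g x - exp (- \<gamma> * a) * g a))"
    proof (rule add_mono)
      have "0 \<le> M" using CM \<open>C > 0\<close> by simp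
      hence "M * (w a * (exp (- \<gamma> * a) * g a)) \<le> M * (w x * (exp (- \<gamma> * a) * g a))"
        using wx g[OF a0] by (intro mult_left_mono mult_right_mono) auto
      with small[of a] a0 show "set_lebesgue_integral lebesgue {0<..<a} f \<le> M * (w x * (exp (- \<gamma> * a) * g a))"
        by (simp add: M_def)
      have "C * (w x * (exp (- \<gamma> * x) * g x - exp (- \<gamma> * a) * g a)) \<le>
            M * (w x * (exp (- \<gamma> * x) * g x - exp (- \<gamma> * a) * g a))"
        using CM wx incr by (intro mult_right_mono) auto
      with tail show "set_lebesgue_integral lebesgue {a<..<x} f \<le>
          M * (w x * (exp (- \<gamma> * x) * g x - exp (- \<gamma> * a) * g a))" by (simp add: mult.assoc)
    qed
    also have "\<dots> = M * (w x * (exp (- \<gamma> * x) * g x))" by (simp add: algebra_simps)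
    finally show ?thesis by (simp add: M_def g_def)
  qed
qed

theorem corollary3p4:
  fixes \<mu> q \<gamma> :: real and w :: "real \<Rightarrow> real"
  assumes "\<mu> > -1" and "q \<ge> 0" and "0 < \<gamma>" and "\<gamma> < 1"
    and "upper_power_weight q w"
  shows
    "(\<forall>x>0. set_integrable lebesgue {0<..<x}
        (\<lambda>t. exp (- \<gamma> * t) * w t * t powr (- \<mu>) * bessel_I \<mu> t)) \<and>
     (\<forall>\<theta>\<in>{\<gamma><..<1}. \<forall>x>0.
        set_lebesgue_integral lebesgue {0<..<x}
          (\<lambda>t. exp (- \<gamma> * t) * w t * t powr (- \<mu>) * bessel_I \<mu> t)
        \<le> M_const \<mu> q \<gamma> \<theta> *
           (exp (- \<gamma> * x) * w x * x powr (- \<mu>) * bessel_I (\<mu> + 1) x)) \<and>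
     (\<forall>x>0.
        set_lebesgue_integral lebesgue {0<..<x}
          (\<lambda>t. exp (- \<gamma> * t) * w t * t powr (- \<mu>) * bessel_I \<mu> t)
        \<le> max (K_const \<mu> q * exp (2 * \<gamma> * (\<mu> + 2) * (1 + \<gamma>) / (1 - \<gamma>)))
               (2 * (2 * \<mu> + 3 + \<gamma>) / ((\<mu> + 2) * (1 - \<gamma>\<^sup>2))) *
           (exp (- \<gamma> * x) * w x * x powr (- \<mu>) * bessel_I (\<mu> + 1) x))"
proof -
  define h where "h = (\<lambda>t. exp (- \<gamma> * t) * w t * t powr (- \<mu>) * bessel_I \<mu> t)"
  define f where "f = (\<lambda>t. exp (- \<gamma> * t) * w t * bessel_entire \<mu> (t\<^sup>2))"
  have hf: "h t = f t" if "t > 0" for t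
    using that assms(1) by (simp add: h_def f_def bessel_I_eq powr_minus)
  have rhs: "exp (- \<gamma> * x) * w x * x powr (- \<mu>) * bessel_I (\<mu> + 1) x =
      w x * (exp (- \<gamma> * x) * (x * bessel_entire (\<mu> + 1) (x\<^sup>2)))" if "x > 0" for x
    using that assms(1) by (simp add: bessel_I_eq powr_minus powr_add)
  have integrable: "set_integrable lebesgue {0<..<x} h" if "x > 0" for x
  proof -
    have "set_integrable lebesgue {0<..<x} f"
      unfolding f_def by (rule weighted_integral_from_zero(1)) (use assms that in auto)
    thus ?thesis by (subst set_integrable_cong[OF refl refl, of _ _ f]) (auto simp: hf)
  qed
  have bound: "set_lebesgue_integral lebesgue {0<..<x} h \<le> M_const \<mu> q \<gamma> \<theta> *
      (exp (- \<gamma> * x) * w x * x powr (- \<mu>) * bessel_I (\<mu> + 1) x)"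
    if "\<gamma> < \<theta>" "\<theta> < 1" "x > 0" for \<theta> x
  proof -
    have "set_lebesgue_integral lebesgue {0<..<x} h = set_lebesgue_integral lebesgue {0<..<x} f"
      by (rule set_lebesgue_integral_cong) (auto simp: hf)
    also have "\<dots> \<le> M_const \<mu> q \<gamma> \<theta> * (w x * (exp (- \<gamma> * x) * (x * bessel_entire (\<mu> + 1) (x\<^sup>2))))"
      unfolding f_def by (rule weighted_integral_bound) (use assms that in auto)
    finally show ?thesis by (simp only: rhs[OF that(3)])
  qed
  have special: "M_const \<mu> q \<gamma> ((1 + \<gamma>) / 2) =
     max (K_const \<mu> q * exp (2 * \<gamma> * (\<mu> + 2) * (1 + \<gamma>) / (1 - \<gamma>)))
         (2 * (2 * \<mu> + 3 + \<gamma>) / ((\<mu> + 2) * (1 - \<gamma>\<^sup>2)))"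
  proof -
    have 1: "2 * \<gamma> * (\<mu> + 2) * ((1 + \<gamma>) / 2) / (1 - (1 + \<gamma>) / 2) = 2 * \<gamma> * (\<mu> + 2) * (1 + \<gamma>) / (1 - \<gamma>)"
      using assms(4) by (simp add: divide_simps)
    have "(\<mu> + 2) * ((1 + \<gamma>) / 2) * ((1 + \<gamma>) / 2 - \<gamma>) = (\<mu> + 2) * (1 - \<gamma>\<^sup>2) / 4"
      by (simp add: power2_eq_square field_simps)
    moreover have "\<mu> + 1 + (1 + \<gamma>) / 2 = 2 * (2 * \<mu> + 3 + \<gamma>) / 4" by simp
    moreover have "(X / 4) / (Y / 4) = X / Y" for X Y :: real by simp
    ultimately have 2: "(\<mu> + 1 + (1 + \<gamma>) / 2) / ((\<mu> + 2) * ((1 + \<gamma>) / 2) * ((1 + \<gamma>) / 2 - \<gamma>)) =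
        2 * (2 * \<mu> + 3 + \<gamma>) / ((\<mu> + 2) * (1 - \<gamma>\<^sup>2))" by (simp only:)
    show ?thesis unfolding M_const_def 1 2 ..
  qed
  have mid: "\<gamma> < (1 + \<gamma>) / 2" "(1 + \<gamma>) / 2 < 1" using assms(4) by auto
  show ?thesis
    unfolding h_def[symmetric] special[symmetric]
    using integrable bound bound[OF mid] by auto
qed

end
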